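(* Suppose that for every $i\in[m]$ the function $f_i$ is gradient Lipschitz continuous with constant $r_i>0$, and let $\{(\mathbf{y}^k,X^k,\Pi^k)\}$ be the sequence generated by the ICEADMM algorithm with $H_i=\Theta_i$ and $\sigma_i>3\sqrt2\,w_ir_i$ for every $i\in[m]$. Suppose that the level set $\mathcal{S}(\varphi^1)$ is bounded. Then: (i) The sequence $\{(\mathbf{y}^k,X^k,\Pi^k)\}$ is bounded, and any accumulation point $(\mathbf{y}^\infty,X^\infty,\Pi^\infty)$ of it is a stationary point of problem (P'); moreover $\mathbf{y}^\infty$ is a stationary point of problem (P). (ii) If, in addition, $\mathbf{y}^\infty$ is isolated (i.e. it is an isolated accumulation point of $\{\mathbf{y}^k\}$), then the whole sequence $\{(\mathbf{y}^k,X^k,\Pi^k)\}$ converges to $(\mathbf{y}^\infty,X^\infty,\Pi^\infty)$.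
   Context: Setting. $m,n\ge 1$ are integers, $[m]=\{1,\dots,m\}$, $w_1,\dots,w_m>0$ with $\sum_i w_i=1$, and each $f_i:\mathbb{R}^n\to\mathbb{R}$ is bounded from below. $f(\mathbf{x}):=\sum_{i=1}^m w_if_i(\mathbf{x})$. Problem (P): $\min_{\mathbf{x}\in\mathbb{R}^n} f(\mathbf{x})$. Problem (P'): $\min_{\mathbf{x},\mathbf{x}_1,\dots,\mathbf{x}_m\in\mathbb{R}^n}\sum_{i=1}^m w_if_i(\mathbf{x}_i)$ subject to $\mathbf{x}_i=\mathbf{x}$, $i\in[m]$. A function $g$ is gradient Lipschitz continuous with constant $r$ if it is differentiable and $\|\nabla g(\mathbf{x})-\nabla g(\mathbf{z})\|\le r\|\mathbf{x}-\mathbf{z}\|$ for all $\mathbf{x},\mathbf{z}$ (Euclidean norm). $\Theta_i$ is a symmetric $n\times n$ matrix with $r_iI\succeq\Theta_i\succeq0$ such that $f_i(\mathbf{x})\le f_i(\mathbf{z})+\langle\nabla f_i(\mathbf{z}),\mathbf{x}-\mathbf{z}\rangle+\frac12\langle\Theta_i(\mathbf{x}-\mathbf{z}),\mathbf{x}-\mathbf{z}\rangle$ for all $\mathbf{x},\mathbf{z}\in\mathbb{R}^n$ (such a matrix exists, e.g. $\Theta_i=r_iI$). Stationary points. $(\mathbf{x}^*,X^*,\Pi^* )$ with $X^*=(\mathbf{x}_1^*,\dots,\mathbf{x}_m^* )$, $\Pi^*=(\boldsymbol{\pi}_1^*,\dots,\boldsymbol{\pi}_m^* )$ is a stationary point of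 (P') if $w_i\nabla f_i(\mathbf{x}_i^* )+\boldsymbol{\pi}_i^*=0$ and $\mathbf{x}_i^*=\mathbf{x}^*$ for all $i\in[m]$, and $\sum_{i=1}^m\boldsymbol{\pi}_i^*=0$. $\mathbf{x}^*$ is a stationary point of (P) if $\nabla f(\mathbf{x}^* )=0$. ICEADMM algorithm. Parameters $\sigma_i>0$, symmetric $H_i\succeq0$ ($i\in[m]$), $\sigma:=\sum_i\sigma_i$, an integer $k_0>0$, initial points $\mathbf{x}_i^0,\boldsymbol{\pi}_i^0\in\mathbb{R}^n$ ($i\in[m]$). Put $\mathcal{K}=\{0,k_0,2k_0,\dots\}$ and $\tau_k=\lfloor k/k_0\rfloor k_0$. For $k=0,1,2,\dots$: if $k\in\mathcal{K}$, set $\mathbf{x}^{k+1}=\sum_{i=1}^m\frac{\sigma_i}{\sigma}\mathbf{x}_i^k+\frac1\sigma\sum_{i=1}^m\boldsymbol{\pi}_i^k$. Then, with $\mathbf{y}^{k+1}:=\mathbf{x}^{\tau_k+1}$, for each $i\in[m]$ set $\mathbf{x}_i^{k+1}=\mathbf{x}_i^k-(w_iH_i+\sigma_iI)^{-1}\big[\sigma_i(\mathbf{x}_i^k-\mathbf{y}^{k+1})+w_i\nabla f_i(\mathbf{x}_i^k)+\boldsymbol{\pi}_i^k\big]$ and $\boldsymbol{\pi}_i^{k+1}=\boldsymbol{\pi}_i^k+\sigma_i(\mathbf{x}_i^{k+1}-\mathbf{y}^{k+1})$. Write $X^k=(\mathbf{x}_1^k,\dots,\mathbf{x}_m^k)$,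 $\Pi^k=(\boldsymbol{\pi}_1^k,\dots,\boldsymbol{\pi}_m^k)$. Notation. For $k\ge1$, $\mathcal{L}^k:=\sum_{i=1}^m\big(w_if_i(\mathbf{x}_i^k)+\langle\mathbf{x}_i^k-\mathbf{y}^k,\boldsymbol{\pi}_i^k\rangle+\frac{\sigma_i}{2}\|\mathbf{x}_i^k-\mathbf{y}^k\|^2\big)$ and $\varphi^k:=\mathcal{L}^k+\sum_{i=1}^m\frac{6w_i^2r_i^2}{\sigma_i}\|\mathbf{x}_i^k-\mathbf{x}_i^{k-1}\|^2$. $\mathcal{S}(\alpha):=\{\mathbf{x}\in\mathbb{R}^n: f(\mathbf{x})\le\alpha\}$. *)

theory Defs
  imports "HOL-Analysis.Analysis"
begin

text \<open>Meaningful only where g is differentiable; there the gradient is unique.\<close>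

definition grad :: "('a::real_inner \<Rightarrow> real) \<Rightarrow> 'a \<Rightarrow> 'a" where
  "grad g x = (THE D. GDERIV g x :> D)"

definition gradient_lipschitz :: "real \<Rightarrow> ('a::real_inner \<Rightarrow> real) \<Rightarrow> bool" where
  "gradient_lipschitz r g \<longleftrightarrow>
     (\<forall>x. g differentiable (at x)) \<and>
     (\<forall>x z. norm (grad g x - grad g z) \<le> r * norm (x - z))"

definition sym_psd :: "real^'n^'n \<Rightarrow> bool" where
  "sym_psd A \<longleftrightarrow> transpose A = A \<and> (\<forall>v. 0 \<le> (A *v v) \<bullet> v)"

definition loewner_le :: "real^'n^'n \<Rightarrow> real^'n^'n \<Rightarrow> bool" where
  "loewner_le A B \<longleftrightarrow> sym_psd (B - A)"

text \<open>Accumulation point of a sequence (as opposed to a limit point of its range):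
  the limit of some subsequence.\<close>

definition seq_acc_point :: "(nat \<Rightarrow> 'a::topological_space) \<Rightarrow> 'a \<Rightarrow> bool" where
  "seq_acc_point s l \<longleftrightarrow> (\<exists>\<rho>::nat \<Rightarrow> nat. strict_mono \<rho> \<and> (s \<circ> \<rho>) \<longlonglongrightarrow> l)"

definition objective :: "('m::finite \<Rightarrow> real) \<Rightarrow> ('m \<Rightarrow> real^'n \<Rightarrow> real) \<Rightarrow> real^'n \<Rightarrow> real" where
  "objective w f x = (\<Sum>i\<in>UNIV. w i * f i x)"

definition level_set :: "('m::finite \<Rightarrow> real) \<Rightarrow> ('m \<Rightarrow> real^'n \<Rightarrow> real) \<Rightarrow> real \<Rightarrow> (real^'n) set" where
  "level_set w f \<alpha> = {x. objective w f x \<le> \<alpha>}"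

text \<open>Stationary points of the unconstrained problem: minimise \<open>objective w f\<close>.\<close>

definition stationary_P ::
  "('m::finite \<Rightarrow> real) \<Rightarrow> ('m \<Rightarrow> real^'n \<Rightarrow> real) \<Rightarrow> real^'n \<Rightarrow> bool" where
  "stationary_P w f x \<longleftrightarrow>
     objective w f differentiable (at x) \<and> grad (objective w f) x = 0"

text \<open>Stationary points of the consensus problem: minimise \<open>\<Sum>i. w i * f i (X $ i)\<close>
  subject to \<open>X $ i = x\<close> for all i, with multipliers \<open>P $ i\<close>.\<close>

definition stationary_P' ::
  "('m::finite \<Rightarrow> real) \<Rightarrow> ('m \<Rightarrow> real^'n \<Rightarrow> real) \<Rightarrow> real^'n \<Rightarrow> real^'n^'m \<Rightarrow> real^'n^'m \<Rightarrow> bool" where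
  "stationary_P' w f x X P \<longleftrightarrow>
     (\<forall>i. f i differentiable (at (X $ i)) \<and>
          w i *\<^sub>R grad (f i) (X $ i) + P $ i = 0 \<and> X $ i = x) \<and>
     (\<Sum>i\<in>UNIV. P $ i) = 0"

text \<open>The iterates of ICEADMM, for arbitrary initial points \<open>X 0\<close> and \<open>P 0\<close>.
  The aggregate \<open>x (k + 1)\<close> is computed (and used) only if \<open>k0\<close> divides k;
  \<open>y (k + 1)\<close> is the latest aggregate. The values \<open>x 0\<close>, \<open>y 0\<close> and
  \<open>x (k + 1)\<close> for other k are unconstrained and play no role.
  Here \<open>mat c\<close> is c times the identity matrix.\<close>

definition ICEADMM ::
  "('m::finite \<Rightarrow> real) \<Rightarrow> ('m \<Rightarrow> real^'n \<Rightarrow> real) \<Rightarrow> ('m \<Rightarrow> real) \<Rightarrow> ('m \<Rightarrow> real^'n^'n) \<Rightarrow> nat \<Rightarrow>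
   (nat \<Rightarrow> real^'n) \<Rightarrow> (nat \<Rightarrow> real^'n) \<Rightarrow> (nat \<Rightarrow> real^'n^'m) \<Rightarrow> (nat \<Rightarrow> real^'n^'m) \<Rightarrow> bool" where
  "ICEADMM w f \<sigma> H k0 x y X P \<longleftrightarrow>
     (\<forall>k.
       (k0 dvd k \<longrightarrow>
          x (k + 1) = (\<Sum>i\<in>UNIV. (\<sigma> i / (\<Sum>j\<in>UNIV. \<sigma> j)) *\<^sub>R X k $ i)
                    + (1 / (\<Sum>j\<in>UNIV. \<sigma> j)) *\<^sub>R (\<Sum>i\<in>UNIV. P k $ i)) \<and>
       y (k + 1) = x ((k div k0) * k0 + 1) \<and>
       (\<forall>i. X (k + 1) $ i = X k $ i -
              matrix_inv (w i *\<^sub>R H i + mat (\<sigma> i)) *v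
                (\<sigma> i *\<^sub>R (X k $ i - y (k + 1)) + w i *\<^sub>R grad (f i) (X k $ i) + P k $ i)) \<and>
       (\<forall>i. P (k + 1) $ i = P k $ i + \<sigma> i *\<^sub>R (X (k + 1) $ i - y (k + 1))))"

definition aug_lagrangian ::
  "('m::finite \<Rightarrow> real) \<Rightarrow> ('m \<Rightarrow> real^'n \<Rightarrow> real) \<Rightarrow> ('m \<Rightarrow> real) \<Rightarrow>
   real^'n \<Rightarrow> real^'n^'m \<Rightarrow> real^'n^'m \<Rightarrow> real" where
  "aug_lagrangian w f \<sigma> y X P =
     (\<Sum>i\<in>UNIV. w i * f i (X $ i) + (X $ i - y) \<bullet> (P $ i) + \<sigma> i / 2 * (norm (X $ i - y))\<^sup>2)"

text \<open>The merit value \<open>\<phi>\<close> at iteration k; only used for \<open>k \<ge> 1\<close>.\<close>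

definition merit ::
  "('m::finite \<Rightarrow> real) \<Rightarrow> ('m \<Rightarrow> real^'n \<Rightarrow> real) \<Rightarrow> ('m \<Rightarrow> real) \<Rightarrow> ('m \<Rightarrow> real) \<Rightarrow>
   (nat \<Rightarrow> real^'n) \<Rightarrow> (nat \<Rightarrow> real^'n^'m) \<Rightarrow> (nat \<Rightarrow> real^'n^'m) \<Rightarrow> nat \<Rightarrow> real" where
  "merit w f \<sigma> r y X P k =
     aug_lagrangian w f \<sigma> (y k) (X k) (P k) +
     (\<Sum>i\<in>UNIV. 6 * (w i)\<^sup>2 * (r i)\<^sup>2 / \<sigma> i * (norm (X k $ i - X (k - 1) $ i))\<^sup>2)"

end

theory Submission
  imports Defs
begin

text \<open>
  Since $\pi_i^{k+1} = -w_i\nabla f_i(x_i^k) - w_i\Theta_i(x_i^{k+1}-x_i^k)$ for every k, the change of the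
  multipliers is controlled by two consecutive primal steps. Hence the merit value decreases from
  step $k \ge 1$ on by at least a multiple of $\sum_i\|x_i^{k+1}-x_i^k\|^2 + \|y^{k+1}-y^k\|^2$; the
  factor for agent i is $\sigma_i/2 - 9w_i^2r_i^2/\sigma_i$, which is positive exactly because
  $\sigma_i > 3\sqrt2\,w_ir_i$. The merit value also dominates $f(y^k)$, so $y^k$ stays in the level
  set and the merit values converge. Therefore all steps vanish, and with them $x_i^k - y^k$,
  $\pi_i^k + w_i\nabla f_i(y^k)$ and $\sum_i\pi_i^k$; for the last one, the aggregation formula gives
  the limit along multiples of $k_0$ and the vanishing steps fill the gaps. So the whole iteration is
  governed by the sequence $y^k$, whose steps vanish.
\<close>

section \<open>Gradients of differentiable functions and of the objective\<close>

lemma GDERIV_grad: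
  fixes g :: "'a::euclidean_space \<Rightarrow> real"
  assumes "g differentiable (at x)"
  shows "GDERIV g x :> grad g x"
proof -
  obtain g' where g': "(g has_derivative g') (at x)"
    using assms by (auto simp: differentiable_def)
  then have "linear g'"
    by (simp add: has_derivative_linear)
  \<comment> \<open>Riesz representation: the adjoint of a real functional, evaluated at 1, is the
    vector representing it. This is the witness for the definite description in
    \<open>grad\<close>.\<close>
  then have "g' = (\<lambda>h. h \<bullet> adjoint g' 1)"
    by (simp add: adjoint_works fun_eq_iff)
  with g' have D: "GDERIV g x :> adjoint g' 1"
    by (simp add: gderiv_def)
  have "D' = adjoint g' 1" if "GDERIV g x :> D'" for D'
  proof -
    have "(\<lambda>h. h \<bullet> D') = (\<lambda>h. h \<bullet> adjoint g' 1)"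
      using that D has_derivative_unique unfolding gderiv_def by blast
    then show ?thesis
      by (metis vector_eq_ldot)
  qed
  with D show ?thesis
    unfolding grad_def by (metis theI)
qed

lemma grad_unique:
  fixes g :: "'a::euclidean_space \<Rightarrow> real"
  assumes "GDERIV g x :> D"
  shows "grad g x = D"
proof -
  have "g differentiable (at x)"
    using assms by (auto simp: gderiv_def differentiable_def)
  then have "(\<lambda>h. h \<bullet> grad g x) = (\<lambda>h. h \<bullet> D)"
    using GDERIV_grad assms has_derivative_unique unfolding gderiv_def by blast
  then show ?thesis
    by (metis vector_eq_ldot)
qed

lemma GDERIV_objective:
  assumes "\<And>i. f i differentiable (at x)"
  shows "GDERIV (objective w f) x :> (\<Sum>i\<in>UNIV. w i *\<^sub>R grad (f i) x)"
proof -
  have "((\<lambda>x. \<Sum>i\<in>UNIV. w i * f i x) has_derivative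
      (\<lambda>h. \<Sum>i\<in>UNIV. w i * (h \<bullet> grad (f i) x))) (at x)"
    using GDERIV_grad[OF assms] unfolding gderiv_def
    by (intro has_derivative_sum has_derivative_mult_right)
  moreover have "objective w f = (\<lambda>x. \<Sum>i\<in>UNIV. w i * f i x)"
    by (simp add: fun_eq_iff objective_def)
  ultimately show ?thesis
    by (simp add: gderiv_def inner_sum_right)
qed

section \<open>Semidefinite matrices and inequalities for a single update\<close>

lemma mat_mult_vec: "mat c *v v = c *\<^sub>R v" for v :: "real^'n"
  unfolding matrix_scaleR[symmetric] by (simp add: matrix_works scaleR_conv_of_real)

text \<open>A spectral norm bound without eigenvalues. Positivity of \<open>A\<close> is tested on
  \<open>r *\<^sub>R v - u\<close> with \<open>u = A *v v\<close>, and the upper bound on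
  \<open>u\<close> itself; together they give
  \<open>u \<bullet> u \<le> r * (u \<bullet> v)\<close>, and Cauchy-Schwarz finishes.\<close>

lemma norm_psd_mult_le:
  fixes A :: "real^'n^'n"
  assumes A: "sym_psd A" and le: "loewner_le A (mat r)" and r: "r > 0"
  shows "norm (A *v v) \<le> r * norm v"
proof -
  define u where "u = A *v v"
  have sym: "(A *v a) \<bullet> b = a \<bullet> (A *v b)" for a b
    using A unfolding sym_psd_def by (metis dot_lmul_matrix vector_transpose_matrix)
  have "0 \<le> (A *v (r *\<^sub>R v - u)) \<bullet> (r *\<^sub>R v - u)"
    using A by (simp add: sym_psd_def)
  moreover have "(A *v u) \<bullet> v = u \<bullet> u"
    by (simp add: sym u_def)
  moreover have "A *v (r *\<^sub>R v - u) = r *\<^sub>R u - A *v u"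
    by (simp add: matrix_vector_mult_diff_distrib matrix_vector_mult_scaleR u_def)
  ultimately have "0 \<le> r * (r * (u \<bullet> v)) - 2 * (r * (u \<bullet> u)) + (A *v u) \<bullet> u"
    by (simp only:) (simp add: inner_diff_left inner_diff_right right_diff_distrib)
  moreover have "(A *v u) \<bullet> u \<le> r * (u \<bullet> u)"
    using le unfolding loewner_le_def sym_psd_def
    by (simp add: matrix_vector_mult_diff_rdistrib inner_diff_left mat_mult_vec)
  ultimately have "r * (u \<bullet> u) \<le> r * (r * (u \<bullet> v))"
    by (simp add: algebra_simps)
  then have "u \<bullet> u \<le> r * (u \<bullet> v)"
    using r by simp
  also have "\<dots> \<le> r * (norm u * norm v)"
    using r by (simp add: norm_cauchy_schwarz)
  finally have "norm u * norm u \<le> norm u * (r * norm v)"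
    by (simp add: dot_square_norm power2_eq_square mult.left_commute)
  then show ?thesis
    using r by (cases "u = 0") (auto simp: u_def)
qed

text \<open>The shift by \<open>s > 0\<close> makes \<open>M\<close> positive definite, so its
  kernel is trivial and \<open>matrix_inv M\<close> is a true inverse. This turns the explicit
  primal update into a linear equation.\<close>

lemma matrix_inv_mult_psd:
  fixes A :: "real^'n^'n"
  assumes A: "sym_psd A" and "w > 0" "s > 0"
  defines "M \<equiv> w *\<^sub>R A + mat s"
  shows "M *v (matrix_inv M *v v) = v"
    and "M *v v = w *\<^sub>R (A *v v) + s *\<^sub>R v"
proof -
  have M: "M *v u = w *\<^sub>R (A *v u) + s *\<^sub>R u" for u
    by (simp add: M_def matrix_vector_mult_add_rdistrib mat_mult_vec scaleR_matrix_vector_assoc)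
  then show "M *v v = w *\<^sub>R (A *v v) + s *\<^sub>R v" .
  have "u = 0" if "M *v u = 0" for u
  proof -
    have "w * ((A *v u) \<bullet> u) + s * (u \<bullet> u) = (M *v u) \<bullet> u"
      by (simp add: M inner_add_left)
    also have "\<dots> = 0"
      by (simp add: that)
    finally have "s * (u \<bullet> u) \<le> 0"
      using A \<open>w > 0\<close> by (smt (verit) mult_nonneg_nonneg sym_psd_def)
    then have "u \<bullet> u \<le> 0"
      using \<open>s > 0\<close> by (simp add: mult_le_0_iff)
    then show ?thesis
      by (metis inner_eq_zero_iff inner_ge_zero order_antisym)
  qed
  then have "invertible M"
    by (simp add: invertible_left_inverse matrix_left_invertible_ker)
  then have "M ** matrix_inv M = mat 1 \<and> matrix_inv M ** M = mat 1"
    unfolding invertible_def matrix_inv_def by (rule someI_ex)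
  then show "M *v (matrix_inv M *v v) = v"
    by (simp add: matrix_vector_mul_assoc)
qed

text \<open>One agent's primal and dual update in abstract form. Eliminating \<open>g\<close> by the
  step equation turns the curvature term of the majorant into
  \<open>- (t \<bullet> (u' - u)) / 2\<close>, which is nonpositive; expanding the square yields the
  gain \<open>s / 2 * (norm (u' - u))\<^sup>2\<close>; the dual ascent costs
  \<open>s * (norm (u' - y))\<^sup>2\<close>, which is the last term.\<close>

lemma prox_step_descent:
  fixes u u' y p p' g t :: "'a::real_inner"
  assumes majorant: "F' \<le> F + g \<bullet> (u' - u) + 1 / 2 * (t \<bullet> (u' - u))"
    and t: "t \<bullet> (u' - u) \<ge> 0"
    and step: "t + s *\<^sub>R (u' - y) + g + p = 0"
    and dual: "p' = p + s *\<^sub>R (u' - y)" and s: "s > 0"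
  shows "F' + (u' - y) \<bullet> p' + s / 2 * (norm (u' - y))\<^sup>2
    \<le> F + (u - y) \<bullet> p + s / 2 * (norm (u - y))\<^sup>2
       - s / 2 * (norm (u' - u))\<^sup>2 + (norm (p' - p))\<^sup>2 / s"
proof -
  define d e where "d = u' - u" and "e = u' - y"
  have u: "u - y = e - d" "u' - y = e" "u' - u = d"
    by (auto simp: d_def e_def)
  have g: "g = - t - s *\<^sub>R e - p"
    using step by (simp add: u algebra_simps eq_neg_iff_add_eq_0)
  have 1: "(norm (p' - p))\<^sup>2 / s = s * (e \<bullet> e)"
    using s by (simp add: dual u power_mult_distrib dot_square_norm power2_eq_square)
  have F: "F' \<le> F - (t \<bullet> d) / 2 - s * (e \<bullet> d) - p \<bullet> d"
    using majorant by (simp add: u g inner_diff_left)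
  have lhs: "e \<bullet> p' + s / 2 * (norm e)\<^sup>2 = e \<bullet> p + s * (e \<bullet> e) + s * (e \<bullet> e) / 2"
    by (simp add: dual u inner_add_right power2_norm_eq_inner)
  have rhs: "(e - d) \<bullet> p + s / 2 * (norm (e - d))\<^sup>2 - s / 2 * (norm d)\<^sup>2
      = e \<bullet> p - p \<bullet> d + s * (e \<bullet> e) / 2 - s * (e \<bullet> d)"
    by (simp add: inner_diff_left inner_diff_right inner_commute power2_norm_eq_inner algebra_simps)
  show ?thesis
    using F lhs rhs t unfolding 1 unfolding u by linarith
qed

lemma norm_add3_sq_le:
  fixes a b c :: "'a::real_normed_vector"
  shows "(norm (a + b + c))\<^sup>2 \<le> 3 * ((norm a)\<^sup>2 + (norm b)\<^sup>2 + (norm c)\<^sup>2)"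
proof -
  have "(norm (a + b + c))\<^sup>2 \<le> (norm a + norm b + norm c)\<^sup>2"
    using norm_triangle_ineq[of "a + b" c] norm_triangle_ineq[of a b] by (intro power_mono) auto
  \<comment> \<open>The two sides differ by the sum of the three squared pairwise
    differences.\<close>
  also have "\<dots> \<le> 3 * ((norm a)\<^sup>2 + (norm b)\<^sup>2 + (norm c)\<^sup>2)"
    using zero_le_power2[of "norm a - norm b"] zero_le_power2[of "norm b - norm c"]
      zero_le_power2[of "norm a - norm c"]
    unfolding power2_eq_square by (simp add: algebra_simps)
  finally show ?thesis .
qed

text \<open>In its point argument the augmented Lagrangian is a quadratic with Hessian
  \<open>S\<close> times the identity, and the hypothesis on \<open>z\<close> says that its gradient
  vanishes at \<open>z\<close>. Its excess at \<open>y\<close> is therefore exactly the quadratic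
  term.\<close>

lemma aug_lagrangian_aggregate:
  fixes X P :: "real^'n^'m"
  assumes S: "S = (\<Sum>i\<in>UNIV. \<sigma> i)"
    and z: "S *\<^sub>R z = (\<Sum>i\<in>UNIV. \<sigma> i *\<^sub>R X $ i) + (\<Sum>i\<in>UNIV. P $ i)"
  shows "aug_lagrangian w f \<sigma> z X P + S / 2 * (norm (z - y))\<^sup>2 = aug_lagrangian w f \<sigma> y X P"
proof -
  have "aug_lagrangian w f \<sigma> z X P - aug_lagrangian w f \<sigma> y X P
      = (\<Sum>i\<in>UNIV. (y - z) \<bullet> (\<sigma> i *\<^sub>R X $ i + P $ i) + \<sigma> i / 2 * (z \<bullet> z - y \<bullet> y))"
    unfolding aug_lagrangian_def sum_subtractf[symmetric] power2_norm_eq_inner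
    by (rule sum.cong) (simp_all add: inner_diff_left inner_diff_right inner_add_right inner_commute field_simps)
  also have "\<dots> = (y - z) \<bullet> (S *\<^sub>R z) + S / 2 * (z \<bullet> z - y \<bullet> y)"
    unfolding z unfolding S
    by (simp add: sum.distrib inner_sum_right[symmetric] sum_distrib_right[symmetric] sum_divide_distrib[symmetric])
  also have "\<dots> = - S / 2 * (norm (z - y))\<^sup>2"
    unfolding power2_norm_eq_inner
    by (simp add: inner_diff_left inner_diff_right inner_commute field_simps)
  finally show ?thesis
    by simp
qed

section \<open>Convergence criteria for sequences with vanishing steps\<close>

lemma tendsto_0_if_subseq_and_steps:
  fixes u :: "nat \<Rightarrow> 'a::real_normed_vector"
  assumes k0: "k0 > 0" and steps: "(\<lambda>k. u (Suc k) - u k) \<longlonglongrightarrow> 0"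
    and sub: "(\<lambda>j. u (k0 * j)) \<longlonglongrightarrow> 0"
  shows "u \<longlonglongrightarrow> 0"
proof -
  have div: "filterlim (\<lambda>k. k div k0) sequentially sequentially"
    unfolding filterlim_at_top using k0
    by (auto intro!: eventually_sequentiallyI[of "_ * k0"] simp: less_eq_div_iff_mult_less_eq)
  \<comment> \<open>From a multiple of \<open>k0\<close> any fixed offset is reached by finitely
    many vanishing steps.\<close>
  have *: "(\<lambda>j. u (k0 * j + t)) \<longlonglongrightarrow> 0" for t
  proof (induction t)
    case (Suc t)
    have "filterlim (\<lambda>j. k0 * j + t) sequentially sequentially"
      using k0 by (intro filterlim_subseq) (auto simp: strict_mono_def)
    from filterlim_compose[OF steps this] Suc
    have "(\<lambda>j. (u (Suc (k0 * j + t)) - u (k0 * j + t)) + u (k0 * j + t)) \<longlonglongrightarrow> 0 + 0"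
      by (intro tendsto_add)
    then show ?case
      by simp
  qed (use sub in simp)
  \<comment> \<open>Summing over all offsets below \<open>k0\<close> removes the dependence on
    \<open>k mod k0\<close>; one of the summands is \<open>norm (u k)\<close>.\<close>
  have "(\<lambda>k. \<Sum>t<k0. norm (u (k0 * (k div k0) + t))) \<longlonglongrightarrow> (\<Sum>t<k0. 0)"
    by (intro tendsto_sum tendsto_norm_zero filterlim_compose[OF * div])
  then have "(\<lambda>k. \<Sum>t<k0. norm (u (k0 * (k div k0) + t))) \<longlonglongrightarrow> 0"
    by simp
  then show ?thesis
  proof (rule Lim_null_comparison[rotated])
    have "norm (u k) \<le> (\<Sum>t<k0. norm (u (k0 * (k div k0) + t)))" for k
      using member_le_sum[of "k mod k0" "{..<k0}" "\<lambda>t. norm (u (k0 * (k div k0) + t))"] k0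
      by simp
    then show "\<forall>\<^sub>F k in sequentially. norm (u k) \<le> (\<Sum>t<k0. norm (u (k0 * (k div k0) + t)))"
      by simp
  qed
qed

text \<open>Two extractions: first the infinitely many indices at which \<open>s\<close> lies in
  \<open>A\<close>, then a convergent subsequence by compactness.\<close>

lemma seq_acc_point_frequently_compact:
  fixes s :: "nat \<Rightarrow> 'a::metric_space"
  assumes "compact A" "\<exists>\<^sub>F k in sequentially. s k \<in> A"
  obtains z where "z \<in> A" "seq_acc_point s z"
proof -
  have "infinite {k. s k \<in> A}"
    using assms(2) by (simp add: cofinite_eq_sequentially[symmetric] frequently_cofinite)
  then obtain \<rho> :: "nat \<Rightarrow> nat" where \<rho>: "strict_mono \<rho>" "\<And>n. s (\<rho> n) \<in> A"
    using infinite_enumerate by blast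
  then obtain l \<rho>' where "l \<in> A" "strict_mono (\<rho>' :: nat \<Rightarrow> nat)" "((s \<circ> \<rho>) \<circ> \<rho>') \<longlonglongrightarrow> l"
    using assms(1)[unfolded compact_def] by (metis comp_apply)
  with \<rho> show ?thesis
    by (intro that[of l]) (auto simp: seq_acc_point_def o_assoc[symmetric] intro!: exI[of _ "\<rho> \<circ> \<rho>'"] strict_mono_o)
qed

text \<open>Small steps cannot jump across an annulus around the isolated point, and by compactness the
  annulus is visited only finitely often.\<close>

lemma tendsto_isolated_acc_point:
  fixes s :: "nat \<Rightarrow> 'a::euclidean_space"
  assumes steps: "(\<lambda>k. s (Suc k) - s k) \<longlonglongrightarrow> 0"
    and iso: "l isolated_in {z. seq_acc_point s z}"
  shows "s \<longlonglongrightarrow> l"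
proof -
  obtain e where e: "e > 0" "\<And>z. seq_acc_point s z \<Longrightarrow> dist l z < e \<Longrightarrow> z = l"
    using iso unfolding isolated_in_dist_Ex_iff by auto
  have acc: "seq_acc_point s l"
    using iso by (simp add: isolated_in_def)
  show ?thesis
  proof (rule tendstoI)
    fix \<epsilon> :: real assume "\<epsilon> > 0"
    \<comment> \<open>As \<open>\<delta> < e\<close>, only \<open>l\<close> can be an accumulation
      point within distance \<open>\<delta>\<close> of \<open>l\<close>. The annulus
      \<open>A\<close> below leaves out the inner ball and with it \<open>l\<close>, so it contains
      none.\<close>
    define \<delta> where "\<delta> = min \<epsilon> (e / 2)"
    have \<delta>: "0 < \<delta>" "\<delta> \<le> \<epsilon>" "\<delta> < e"
      using \<open>\<epsilon> > 0\<close> e(1) by (auto simp: \<delta>_def min_def)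
    define A where "A = cball l \<delta> - ball l (\<delta> / 2)"
    have "compact A"
      unfolding A_def by (intro compact_diff) auto
    have "\<forall>\<^sub>F k in sequentially. s k \<notin> A"
    proof (rule ccontr)
      assume "\<not> ?thesis"
      then have "\<exists>\<^sub>F k in sequentially. s k \<in> A"
        by (simp add: frequently_def)
      then obtain z where "z \<in> A" "seq_acc_point s z"
        using seq_acc_point_frequently_compact[OF \<open>compact A\<close>] by blast
      with e(2)[of z] \<delta> show False
        by (auto simp: A_def)
    qed
    moreover have "\<forall>\<^sub>F k in sequentially. dist (s (Suc k)) (s k) < \<delta> / 2"
      using tendstoD[OF steps, of "\<delta> / 2"] \<delta> by (simp add: dist_norm)
    ultimately have "\<forall>\<^sub>F k in sequentially. s k \<notin> A \<and> dist (s (Suc k)) (s k) < \<delta> / 2"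
      by (rule eventually_conj)
    then obtain N where N: "\<And>k. k \<ge> N \<Longrightarrow> s k \<notin> A" "\<And>k. k \<ge> N \<Longrightarrow> dist (s (Suc k)) (s k) < \<delta> / 2"
      by (auto simp: eventually_sequentially)
    obtain \<rho> where \<rho>: "strict_mono \<rho>" "(s \<circ> \<rho>) \<longlonglongrightarrow> l"
      using acc by (auto simp: seq_acc_point_def)
    have "\<forall>\<^sub>F n in sequentially. dist (s (\<rho> n)) l < \<delta> / 2 \<and> \<rho> n \<ge> N"
      using tendstoD[OF \<rho>(2), of "\<delta> / 2"] \<delta> filterlim_subseq[OF \<rho>(1)]
      by (auto simp: filterlim_at_top intro: eventually_conj)
    then obtain K where K: "dist (s K) l < \<delta> / 2" "K \<ge> N"
      using eventually_happens'[OF sequentially_bot] by blast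
    \<comment> \<open>The inner ball is invariant: a step shorter than \<open>\<delta> / 2\<close>
      from it stays in \<open>cball l \<delta>\<close>, and avoiding \<open>A\<close> leaves only
      the inner ball.\<close>
    have "dist (s k) l < \<delta> / 2" if "k \<ge> K" for k
      using that
    proof (induction k rule: dec_induct)
      case (step k)
      have "dist (s (Suc k)) l \<le> \<delta>"
        using step N(2)[of k] K dist_triangle[of "s (Suc k)" l "s k"] by auto
      moreover have "s (Suc k) \<notin> A"
        using N(1) step K by simp
      ultimately show ?case
        by (auto simp: A_def dist_commute)
    qed (use K in simp)
    then have "\<forall>k\<ge>K. dist (s k) l < \<epsilon>"
      using \<delta> by (smt (verit) field_sum_of_halves)
    then show "\<forall>\<^sub>F k in sequentially. dist (s k) l < \<epsilon>"
      by (auto simp: eventually_sequentially)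
  qed
qed

lemma bounded_vec_image:
  fixes V :: "'b \<Rightarrow> 'a::real_normed_vector^'m"
  assumes "\<And>i. bounded ((\<lambda>k. V k $ i) ` A)"
  shows "bounded (V ` A)"
proof -
  obtain B where B: "\<And>i k. k \<in> A \<Longrightarrow> norm (V k $ i) \<le> B i"
    using assms unfolding bounded_iff by (simp add: image_iff) metis
  have "norm (V k) \<le> sum B UNIV" if "k \<in> A" for k
  proof -
    have "norm (V k) \<le> (\<Sum>i\<in>UNIV. norm (V k $ i))"
      unfolding norm_vec_def by (rule L2_set_le_sum) simp
    also have "\<dots> \<le> sum B UNIV"
      using B that by (intro sum_mono) simp
    finally show ?thesis .
  qed
  then show ?thesis
    by (auto simp: bounded_iff)
qed

text \<open>Made for the descent inequality, which controls steps only from index 1 on; hence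
  \<open>Suc k\<close> in the hypothesis.\<close>

lemma null_if_sq_le:
  fixes u :: "nat \<Rightarrow> 'a::real_normed_vector" and C :: real
  assumes "C > 0" "v \<longlonglongrightarrow> 0" "\<And>k. C * (norm (u (Suc k)))\<^sup>2 \<le> v k"
  shows "u \<longlonglongrightarrow> 0"
proof -
  have "(\<lambda>k. C * (norm (u (Suc k)))\<^sup>2) \<longlonglongrightarrow> 0"
    using assms(1,3) by (intro tendsto_sandwich[OF _ _ tendsto_const assms(2)]) (auto intro!: always_eventually)
  then have "(\<lambda>k. (1 / C) * (C * (norm (u (Suc k)))\<^sup>2)) \<longlonglongrightarrow> (1 / C) * 0"
    by (rule tendsto_mult_left)
  then have "(\<lambda>k. (norm (u (Suc k)))\<^sup>2) \<longlonglongrightarrow> 0"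
    using assms(1) by simp
  from tendsto_real_sqrt[OF this] have "(\<lambda>k. u (Suc k)) \<longlonglongrightarrow> 0"
    by (simp add: tendsto_norm_zero_iff)
  then show ?thesis
    by (rule LIMSEQ_imp_Suc)
qed

section \<open>The setting, its weighted quantities and their constants\<close>

locale iceadmm =
  fixes w :: "'m::finite \<Rightarrow> real"
    and f :: "'m \<Rightarrow> real^'n \<Rightarrow> real"
    and r \<sigma> :: "'m \<Rightarrow> real"
    and \<Theta> :: "'m \<Rightarrow> real^'n^'n"
    and k0 :: nat
    and x y :: "nat \<Rightarrow> real^'n"
    and X P :: "nat \<Rightarrow> real^'n^'m"
  assumes w_pos: "\<And>i. w i > 0"
    and f_bdd_below: "\<And>i. bdd_below (range (f i))"
    and r_pos: "\<And>i. r i > 0"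
    and f_grad_lipschitz: "\<And>i. gradient_lipschitz (r i) (f i)"
    and \<Theta>_psd: "\<And>i. sym_psd (\<Theta> i)"
    and \<Theta>_le: "\<And>i. loewner_le (\<Theta> i) (mat (r i))"
    and \<Theta>_majorant: "\<And>i u v. f i u \<le> f i v + grad (f i) v \<bullet> (u - v)
                              + 1 / 2 * ((\<Theta> i *v (u - v)) \<bullet> (u - v))"
    and \<sigma>_pos: "\<And>i. \<sigma> i > 0"
    and \<sigma>_large: "\<And>i. \<sigma> i > 3 * sqrt 2 * w i * r i"
    and k0_pos: "k0 > 0"
    and iterates: "ICEADMM w f \<sigma> \<Theta> k0 x y X P"
begin

text \<open>The weight is built into \<open>G\<close> and \<open>T\<close>, so that both have
  Lipschitz constant \<open>w i * r i\<close>.\<close>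

definition "G i v = w i *\<^sub>R grad (f i) v"
definition "T i v = w i *\<^sub>R (\<Theta> i *v v)"
definition "D k i = X (Suc k) $ i - X k $ i"
definition "S = (\<Sum>i\<in>UNIV. \<sigma> i)"
text \<open>What remains of the primal gain \<open>\<sigma> i / 2\<close> after paying 3 units of
  \<open>(w i * r i)\<^sup>2 / \<sigma> i\<close> for the multiplier change and 6 for the new
  penalty.\<close>

definition "c i = \<sigma> i / 2 - 9 * (w i * r i)\<^sup>2 / \<sigma> i"

text \<open>The merit value is a sum over agents of \<open>agent\<close> and \<open>penalty\<close>,
  so the estimates can be made for each agent separately.\<close>

definition "agent i v u p = w i * f i u + (u - v) \<bullet> p + \<sigma> i / 2 * (norm (u - v))\<^sup>2"
definition "penalty i d = 6 * (w i)\<^sup>2 * (r i)\<^sup>2 / \<sigma> i * (norm d)\<^sup>2"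

abbreviation "\<phi> \<equiv> merit w f \<sigma> r y X P"

lemma wr_pos: "w i * r i > 0"
  using w_pos r_pos by simp

lemma S_pos: "S > 0"
  unfolding S_def by (rule sum_pos) (use \<sigma>_pos in auto)

lemma \<sigma>_sq: "18 * (w i * r i)\<^sup>2 < (\<sigma> i)\<^sup>2"
proof -
  have "(3 * sqrt 2 * w i * r i)\<^sup>2 < (\<sigma> i)\<^sup>2"
    using \<sigma>_large[of i] wr_pos[of i] by (intro power_strict_mono) (auto simp: mult.assoc)
  then show ?thesis
    by (simp add: power_mult_distrib)
qed

lemma c_pos: "c i > 0"
  unfolding c_def using \<sigma>_sq[of i] \<sigma>_pos[of i] by (simp add: field_simps power2_eq_square)

lemma c_sq_nonneg: "0 \<le> c i * (norm v)\<^sup>2"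
  using less_imp_le[OF c_pos] by (intro mult_nonneg_nonneg) auto

text \<open>This is the coefficient of the consensus residual in \<open>merit_lower\<close>. The
  bound \<open>3 * (w i * r i) < \<sigma> i\<close>, drawn from \<open>\<sigma>_sq\<close>, suffices
  for it.\<close>

lemma \<sigma>_gt: "\<sigma> i / 3 - w i * r i / 2 > 0"
proof -
  have "(3 * (w i * r i))\<^sup>2 < (\<sigma> i)\<^sup>2"
    using \<sigma>_sq[of i] zero_le_power2[of "w i * r i"] unfolding power_mult_distrib[of 3] power2_eq_square[of 3]
    by linarith
  then have "3 * (w i * r i) < \<sigma> i"
    using less_imp_le[OF \<sigma>_pos] by (rule power_less_imp_less_base)
  then show ?thesis
    using wr_pos[of i] by linarith
qed

lemma differentiable: "f i differentiable (at u)"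
  using f_grad_lipschitz unfolding gradient_lipschitz_def by blast

lemma G_lipschitz: "norm (G i u - G i v) \<le> w i * r i * norm (u - v)"
  using f_grad_lipschitz[of i] w_pos[of i]
  by (simp add: G_def gradient_lipschitz_def scaleR_diff_right[symmetric])

lemma T_nonneg: "0 \<le> T i v \<bullet> v"
  using \<Theta>_psd[of i] w_pos[of i] by (simp add: T_def sym_psd_def)

lemma T_norm: "norm (T i v) \<le> w i * r i * norm v"
  using norm_psd_mult_le[OF \<Theta>_psd \<Theta>_le r_pos, of i v] w_pos[of i] by (simp add: T_def)

lemma T_inner_le: "T i v \<bullet> v \<le> w i * r i * (norm v)\<^sup>2"
proof -
  have "T i v \<bullet> v \<le> norm (T i v) * norm v"
    by (rule norm_cauchy_schwarz)
  also have "\<dots> \<le> w i * r i * norm v * norm v"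
    by (intro mult_right_mono T_norm) simp
  finally show ?thesis
    by (simp add: power2_eq_square)
qed

lemma majorant: "w i * f i u \<le> w i * f i v + G i v \<bullet> (u - v) + 1 / 2 * (T i (u - v) \<bullet> (u - v))"
  using mult_left_mono[OF \<Theta>_majorant[of i u v], of "w i"] w_pos[of i]
  by (simp add: G_def T_def algebra_simps)

section \<open>Recursions satisfied by the iterates\<close>

lemma P_Suc: "P (Suc k) $ i = P k $ i + \<sigma> i *\<^sub>R (X (Suc k) $ i - y (Suc k))"
  using iterates unfolding ICEADMM_def by simp

lemma X_step: "T i (D k i) + \<sigma> i *\<^sub>R (X (Suc k) $ i - y (Suc k)) + G i (X k $ i) + P k $ i = 0"
proof -
  define M where "M = w i *\<^sub>R \<Theta> i + mat (\<sigma> i)"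
  define q where "q = \<sigma> i *\<^sub>R (X k $ i - y (Suc k)) + G i (X k $ i) + P k $ i"
  have "D k i = - (matrix_inv M *v q)"
    using iterates unfolding ICEADMM_def D_def M_def q_def G_def by simp
  then have "M *v D k i = - q"
    using matrix_inv_mult_psd(1)[OF \<Theta>_psd w_pos \<sigma>_pos, of i i i q]
    by (simp add: M_def linear_neg[OF matrix_vector_mul_linear])
  then have "T i (D k i) + \<sigma> i *\<^sub>R D k i = - q"
    using matrix_inv_mult_psd(2)[OF \<Theta>_psd w_pos \<sigma>_pos, of i i i] by (simp add: M_def T_def)
  \<comment> \<open>Moving the \<open>\<sigma> i\<close> part to the right replaces
    \<open>X k $ i\<close> by \<open>X (Suc k) $ i\<close> in the proximal term of
    \<open>q\<close>.\<close>
  then have "T i (D k i) = - q - \<sigma> i *\<^sub>R D k i"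
    by (simp add: eq_diff_eq)
  then show ?thesis
    by (simp add: q_def D_def algebra_simps)
qed

text \<open>\<open>X_step\<close> already contains the new multiplier: by \<open>P_Suc\<close> its
  proximal term and \<open>P k $ i\<close> add up to \<open>P (Suc k) $ i\<close>. The gradient
  stays at the old point.\<close>

lemma P_Suc_eq: "P (Suc k) $ i = - G i (X k $ i) - T i (D k i)"
proof -
  have "P (Suc k) $ i = (T i (D k i) + \<sigma> i *\<^sub>R (X (Suc k) $ i - y (Suc k)) + G i (X k $ i) + P k $ i)
      - G i (X k $ i) - T i (D k i)"
    by (simp add: P_Suc)
  then show ?thesis
    by (simp only: X_step) simp
qed

lemma y_aggregate:
  assumes "k0 dvd k"
  shows "S *\<^sub>R y (Suc k) = (\<Sum>i\<in>UNIV. \<sigma> i *\<^sub>R X k $ i) + (\<Sum>i\<in>UNIV. P k $ i)"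
proof -
  have "x (Suc k) = (\<Sum>i\<in>UNIV. (\<sigma> i / S) *\<^sub>R X k $ i) + (1 / S) *\<^sub>R (\<Sum>i\<in>UNIV. P k $ i)"
    and "y (Suc k) = x ((k div k0) * k0 + 1)"
    using iterates assms unfolding ICEADMM_def S_def by simp_all
  then have "y (Suc k) = (\<Sum>i\<in>UNIV. (\<sigma> i / S) *\<^sub>R X k $ i) + (1 / S) *\<^sub>R (\<Sum>i\<in>UNIV. P k $ i)"
    using assms by simp
  then show ?thesis
    using S_pos by (simp add: scaleR_add_right scaleR_sum_right)
qed

text \<open>\<open>y (Suc (Suc k))\<close> belongs to iteration \<open>Suc k\<close>, so
  divisibility of \<open>Suc k\<close> decides. Without it, \<open>k\<close> and
  \<open>Suc k\<close> have the same quotient by \<open>k0\<close> and use the same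
  aggregate.\<close>

lemma y_same:
  assumes "\<not> k0 dvd Suc k"
  shows "y (Suc (Suc k)) = y (Suc k)"
proof -
  have "Suc k div k0 = k div k0"
    using assms by (simp add: div_Suc dvd_eq_mod_eq_0)
  moreover have "y (Suc k) = x ((k div k0) * k0 + 1)" for k
    using iterates unfolding ICEADMM_def by simp
  ultimately show ?thesis
    by simp
qed

section \<open>Descent and lower bound of the merit value\<close>

lemma y_descent:
  "aug_lagrangian w f \<sigma> (y (Suc (Suc k))) (X (Suc k)) (P (Suc k))
      + S / 2 * (norm (y (Suc (Suc k)) - y (Suc k)))\<^sup>2
    = aug_lagrangian w f \<sigma> (y (Suc k)) (X (Suc k)) (P (Suc k))"
proof (cases "k0 dvd Suc k")
  case True
  then show ?thesis
    by (intro aug_lagrangian_aggregate S_def y_aggregate)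
next
  \<comment> \<open>Between aggregations \<open>y\<close> stands still and the gain is zero, so
    equality persists.\<close>
  case False
  then show ?thesis
    by (simp add: y_same)
qed

text \<open>\<open>P_Suc_eq\<close> at two consecutive indices splits the difference into a gradient
  change and two \<open>T\<close> terms. With the factor 3 for three summands, the new step is
  charged once and the old step twice, whence 3 and 6. Two applications of \<open>P_Suc_eq\<close>
  are why the descent starts at index 1.\<close>

lemma P_diff_sq:
  "(norm (P (Suc (Suc k)) $ i - P (Suc k) $ i))\<^sup>2
    \<le> 3 * (w i * r i)\<^sup>2 * (norm (D (Suc k) i))\<^sup>2 + 6 * (w i * r i)\<^sup>2 * (norm (D k i))\<^sup>2"
proof -
  have "P (Suc (Suc k)) $ i - P (Suc k) $ i
      = (G i (X k $ i) - G i (X (Suc k) $ i)) + (- T i (D (Suc k) i)) + T i (D k i)"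
    by (simp add: P_Suc_eq)
  then have "(norm (P (Suc (Suc k)) $ i - P (Suc k) $ i))\<^sup>2
      \<le> 3 * ((norm (G i (X k $ i) - G i (X (Suc k) $ i)))\<^sup>2
        + (norm (T i (D (Suc k) i)))\<^sup>2 + (norm (T i (D k i)))\<^sup>2)"
    using norm_add3_sq_le[of "G i (X k $ i) - G i (X (Suc k) $ i)" "- T i (D (Suc k) i)" "T i (D k i)"]
    by simp
  also have "\<dots> \<le> 3 * ((w i * r i * norm (D k i))\<^sup>2
        + (w i * r i * norm (D (Suc k) i))\<^sup>2 + (w i * r i * norm (D k i))\<^sup>2)"
    using G_lipschitz[of i "X k $ i" "X (Suc k) $ i"]
    by (intro mult_left_mono add_mono power_mono T_norm) (auto simp: D_def norm_minus_commute)
  finally show ?thesis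
    by (simp add: power_mult_distrib algebra_simps)
qed

lemma aug_lagrangian_eq:
  "aug_lagrangian w f \<sigma> v Y Q = (\<Sum>i\<in>UNIV. agent i v (Y $ i) (Q $ i))"
  by (simp only: aug_lagrangian_def agent_def)

lemma merit_Suc:
  "\<phi> (Suc k) = (\<Sum>i\<in>UNIV. agent i (y (Suc k)) (X (Suc k) $ i) (P (Suc k) $ i))
    + (\<Sum>i\<in>UNIV. penalty i (D k i))"
  by (simp only: merit_def aug_lagrangian_eq penalty_def D_def diff_Suc_1)

text \<open>The dual ascent may raise the Lagrangian by an amount that involves the previous step
  \<open>D k i\<close>. The penalty stored in the previous merit value pays for that part.\<close>

lemma agent_descent:
  "agent i (y (Suc (Suc k))) (X (Suc (Suc k)) $ i) (P (Suc (Suc k)) $ i)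
      + penalty i (D (Suc k) i) + c i * (norm (D (Suc k) i))\<^sup>2
    \<le> agent i (y (Suc (Suc k))) (X (Suc k) $ i) (P (Suc k) $ i) + penalty i (D k i)"
  (is "?A + ?B + ?C \<le> ?A' + ?B'")
proof -
  have "?A \<le> ?A' - \<sigma> i / 2 * (norm (D (Suc k) i))\<^sup>2
      + (norm (P (Suc (Suc k)) $ i - P (Suc k) $ i))\<^sup>2 / \<sigma> i"
    unfolding D_def agent_def
  proof (rule prox_step_descent)
    show "T i (D (Suc k) i) + \<sigma> i *\<^sub>R (X (Suc (Suc k)) $ i - y (Suc (Suc k)))
        + G i (X (Suc k) $ i) + P (Suc k) $ i = 0"
      by (rule X_step)
  qed (use majorant T_nonneg \<sigma>_pos P_Suc in \<open>auto simp: D_def\<close>)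
  also have "(norm (P (Suc (Suc k)) $ i - P (Suc k) $ i))\<^sup>2 / \<sigma> i
      \<le> (3 * (w i * r i)\<^sup>2 * (norm (D (Suc k) i))\<^sup>2 + 6 * (w i * r i)\<^sup>2 * (norm (D k i))\<^sup>2) / \<sigma> i"
    using P_diff_sq \<sigma>_pos[of i] by (intro divide_right_mono) auto
  \<comment> \<open>The old-step part is exactly the old penalty; for the new step, the 3 from the
    multipliers and the 6 of its penalty make the 9 in \<open>c\<close>.\<close>
  also have "\<dots> = ?B' + (\<sigma> i / 2 * (norm (D (Suc k) i))\<^sup>2 - ?B - ?C)"
  proof -
    have "(3 * l * n + 6 * l * m) / s
        = 6 * l / s * m + (s / 2 * n - 6 * l / s * n - (s / 2 - 9 * l / s) * n)" for l m n s :: real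
      by (simp add: add_divide_distrib algebra_simps)
    from this[of "(w i * r i)\<^sup>2"] show ?thesis
      by (simp only: c_def penalty_def power_mult_distrib mult.assoc)
  qed
  finally show ?thesis
    by simp
qed

text \<open>An iteration first moves \<open>y\<close> with \<open>X\<close> and \<open>P\<close>
  fixed, then every agent with the new \<open>y\<close> fixed; \<open>y_descent\<close> and
  \<open>agent_descent\<close> chain in this order.\<close>

lemma merit_descent:
  "\<phi> (Suc (Suc k)) + (\<Sum>i\<in>UNIV. c i * (norm (D (Suc k) i))\<^sup>2)
      + S / 2 * (norm (y (Suc (Suc k)) - y (Suc k)))\<^sup>2 \<le> \<phi> (Suc k)"
proof -
  have "(\<Sum>i\<in>UNIV. agent i (y (Suc (Suc k))) (X (Suc (Suc k)) $ i) (P (Suc (Suc k)) $ i)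
        + penalty i (D (Suc k) i) + c i * (norm (D (Suc k) i))\<^sup>2)
      \<le> (\<Sum>i\<in>UNIV. agent i (y (Suc (Suc k))) (X (Suc k) $ i) (P (Suc k) $ i) + penalty i (D k i))"
    by (intro sum_mono agent_descent)
  then show ?thesis
    using y_descent[of k] by (simp add: merit_Suc aug_lagrangian_eq sum.distrib)
qed

text \<open>The majorant centred at \<open>X (Suc k) $ i\<close> and evaluated at
  \<open>y (Suc k)\<close> bounds the objective. Its gradient term is the multiplier term up to the
  defect \<open>p\<close>, which is of the size of the last step and is absorbed by the penalty. The
  coefficient arises as \<open>s / 2 - s / 6 - L / 2\<close>.\<close>

lemma merit_lower:
  "objective w f (y (Suc k))
      + (\<Sum>i\<in>UNIV. (\<sigma> i / 3 - w i * r i / 2) * (norm (X (Suc k) $ i - y (Suc k)))\<^sup>2)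
    \<le> \<phi> (Suc k)"
  unfolding objective_def merit_Suc sum.distrib[symmetric]
proof (rule sum_mono)
  fix i
  define e d L s where "e = X (Suc k) $ i - y (Suc k)" and "d = D k i" and "L = w i * r i" and "s = \<sigma> i"
  \<comment> \<open>The failure of the new multiplier to cancel the gradient at the new point; it is
    nonzero in general because \<open>P_Suc_eq\<close> uses the old point.\<close>
  define p where "p = P (Suc k) $ i + G i (X (Suc k) $ i)"
  have L: "L > 0" and s: "s > 0"
    using wr_pos \<sigma>_pos by (auto simp: L_def s_def)
  have "norm p \<le> norm (G i (X (Suc k) $ i) - G i (X k $ i)) + norm (T i d)"
    using norm_triangle_ineq4[of "G i (X (Suc k) $ i) - G i (X k $ i)" "T i d"]
    by (simp add: p_def P_Suc_eq d_def algebra_simps)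
  also have "\<dots> \<le> 2 * L * norm d"
    using G_lipschitz[of i "X (Suc k) $ i" "X k $ i"] T_norm[of i d]
    by (simp add: L_def d_def D_def)
  finally have p: "norm p \<le> 2 * L * norm d" .
  have "- (e \<bullet> p) \<le> norm e * norm p"
    using Cauchy_Schwarz_ineq2[of e p] by linarith
  also have "\<dots> \<le> norm e * (2 * L * norm d)"
    using p by (intro mult_left_mono) auto
  \<comment> \<open>Young's inequality, weighted so that the first term is exactly the
    penalty.\<close>
  also have "\<dots> \<le> 6 * L\<^sup>2 / s * (norm d)\<^sup>2 + s / 6 * (norm e)\<^sup>2"
  proof -
    have "0 \<le> (6 * L * norm d - s * norm e)\<^sup>2"
      by simp
    then have "12 * s * (norm e * (L * norm d)) \<le> 36 * L\<^sup>2 * (norm d)\<^sup>2 + s\<^sup>2 * (norm e)\<^sup>2"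
      by (simp add: power2_diff power_mult_distrib algebra_simps)
    then show ?thesis
      using s by (simp add: field_simps power2_eq_square)
  qed
  finally have 1: "- (e \<bullet> p) \<le> 6 * L\<^sup>2 / s * (norm d)\<^sup>2 + s / 6 * (norm e)\<^sup>2" .
  have "T i (y (Suc k) - X (Suc k) $ i) \<bullet> (y (Suc k) - X (Suc k) $ i) \<le> L * (norm e)\<^sup>2"
    using T_inner_le[of i "y (Suc k) - X (Suc k) $ i"] by (simp add: L_def e_def norm_minus_commute)
  then have "w i * f i (y (Suc k)) \<le> w i * f i (X (Suc k) $ i) - G i (X (Suc k) $ i) \<bullet> e + L / 2 * (norm e)\<^sup>2"
    using majorant[of i "y (Suc k)" "X (Suc k) $ i"]
      inner_minus_right[of "G i (X (Suc k) $ i)" e] by (simp add: e_def del: inner_minus_right)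
  then have 2: "w i * f i (y (Suc k)) \<le> w i * f i (X (Suc k) $ i) + e \<bullet> (P (Suc k) $ i) - e \<bullet> p + L / 2 * (norm e)\<^sup>2"
    by (simp add: p_def inner_add_right inner_commute)
  have 3: "(s / 3 - L / 2) * (norm e)\<^sup>2 = s / 2 * (norm e)\<^sup>2 - s / 6 * (norm e)\<^sup>2 - L / 2 * (norm e)\<^sup>2"
    by (simp add: field_simps)
  have "w i * f i (y (Suc k)) + (s / 3 - L / 2) * (norm e)\<^sup>2
      \<le> w i * f i (X (Suc k) $ i) + e \<bullet> (P (Suc k) $ i) + s / 2 * (norm e)\<^sup>2 + 6 * L\<^sup>2 / s * (norm d)\<^sup>2"
    using 1 2 3 by linarith
  then show "w i * f i (y (Suc k)) + (\<sigma> i / 3 - w i * r i / 2) * (norm (X (Suc k) $ i - y (Suc k)))\<^sup>2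
      \<le> agent i (y (Suc k)) (X (Suc k) $ i) (P (Suc k) $ i) + penalty i (D k i)"
    by (simp add: agent_def penalty_def e_def d_def L_def s_def power_mult_distrib)
qed

lemma objective_le_merit: "objective w f (y (Suc k)) \<le> \<phi> (Suc k)"
proof -
  have "0 \<le> (\<Sum>i\<in>UNIV. (\<sigma> i / 3 - w i * r i / 2) * (norm (X (Suc k) $ i - y (Suc k)))\<^sup>2)"
    using \<sigma>_gt by (intro sum_nonneg mult_nonneg_nonneg) (auto intro: less_imp_le)
  then show ?thesis
    using merit_lower[of k] by linarith
qed

lemma merit_decseq: "decseq (\<lambda>k. \<phi> (Suc k))"
proof (rule decseq_SucI)
  fix k
  have "0 \<le> (\<Sum>i\<in>UNIV. c i * (norm (D (Suc k) i))\<^sup>2)"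
    by (intro sum_nonneg c_sq_nonneg)
  moreover have "0 \<le> S / 2 * (norm (y (Suc (Suc k)) - y (Suc k)))\<^sup>2"
    using S_pos by simp
  ultimately show "\<phi> (Suc (Suc k)) \<le> \<phi> (Suc k)"
    using merit_descent[of k] by linarith
qed

lemma y_in_level_set: "y (Suc k) \<in> level_set w f (\<phi> 1)"
  using objective_le_merit[of k] decseqD[OF merit_decseq, of 0 k] by (simp add: level_set_def)

section \<open>Vanishing steps and residuals\<close>

lemma merit_steps_null: "(\<lambda>k. \<phi> (Suc k) - \<phi> (Suc (Suc k))) \<longlonglongrightarrow> 0"
proof -
  define B where "B i = Inf (range (f i))" for i
  have B: "B i \<le> f i u" for i u
    unfolding B_def by (rule cInf_lower[OF rangeI f_bdd_below])
  \<comment> \<open>The weighted infima bound the decreasing merit values from below, so these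
    converge.\<close>
  have "(\<Sum>i\<in>UNIV. w i * B i) \<le> \<phi> (Suc k)" for k
  proof -
    have "(\<Sum>i\<in>UNIV. w i * B i) \<le> objective w f (y (Suc k))"
      unfolding objective_def using B w_pos by (intro sum_mono mult_left_mono) (auto intro: less_imp_le)
    with objective_le_merit[of k] show ?thesis
      by simp
  qed
  then obtain l where l: "(\<lambda>k. \<phi> (Suc k)) \<longlonglongrightarrow> l"
    using decseq_convergent[OF merit_decseq] by metis
  from tendsto_diff[OF this LIMSEQ_Suc[OF this]] show ?thesis
    by simp
qed

lemma y_steps_null: "(\<lambda>k. y (Suc k) - y k) \<longlonglongrightarrow> 0"
proof (rule null_if_sq_le[OF _ merit_steps_null])
  show "S / 2 > 0"
    using S_pos by simp
  fix k
  have "0 \<le> (\<Sum>i\<in>UNIV. c i * (norm (D (Suc k) i))\<^sup>2)"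
    by (intro sum_nonneg c_sq_nonneg)
  then show "S / 2 * (norm (y (Suc (Suc k)) - y (Suc k)))\<^sup>2 \<le> \<phi> (Suc k) - \<phi> (Suc (Suc k))"
    using merit_descent[of k] by linarith
qed

lemma D_null: "(\<lambda>k. D k i) \<longlonglongrightarrow> 0"
proof (rule null_if_sq_le[OF c_pos merit_steps_null])
  fix k
  have "c i * (norm (D (Suc k) i))\<^sup>2 \<le> (\<Sum>i\<in>UNIV. c i * (norm (D (Suc k) i))\<^sup>2)"
    by (intro member_le_sum c_sq_nonneg) auto
  moreover have "0 \<le> S / 2 * (norm (y (Suc (Suc k)) - y (Suc k)))\<^sup>2"
    using S_pos by simp
  ultimately show "c i * (norm (D (Suc k) i))\<^sup>2 \<le> \<phi> (Suc k) - \<phi> (Suc (Suc k))"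
    using merit_descent[of k] by linarith
qed

lemma T_null: "u \<longlonglongrightarrow> 0 \<Longrightarrow> (\<lambda>k. T i (u k)) \<longlonglongrightarrow> 0"
  by (rule Lim_null_comparison[where g = "\<lambda>k. w i * r i * norm (u k)"])
    (auto intro!: always_eventually tendsto_mult_right_zero tendsto_norm_zero simp: T_norm)

lemma G_diff_null: "(\<lambda>k. u k - v k) \<longlonglongrightarrow> 0 \<Longrightarrow> (\<lambda>k. G i (u k) - G i (v k)) \<longlonglongrightarrow> 0"
  by (rule Lim_null_comparison[where g = "\<lambda>k. w i * r i * norm (u k - v k)"])
    (auto intro!: always_eventually tendsto_mult_right_zero tendsto_norm_zero simp: G_lipschitz)

lemma G_X_null: "(\<lambda>k. G i (X (Suc k) $ i) - G i (X k $ i)) \<longlonglongrightarrow> 0"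
  using D_null[of i] unfolding D_def by (rule G_diff_null)

lemma P_steps_null: "(\<lambda>k. P (Suc k) $ i - P k $ i) \<longlonglongrightarrow> 0"
proof (rule LIMSEQ_imp_Suc)
  have "(\<lambda>k. T i (D k i) - T i (D (Suc k) i) - (G i (X (Suc k) $ i) - G i (X k $ i))) \<longlonglongrightarrow> 0 - 0 - 0"
    by (intro tendsto_diff T_null D_null LIMSEQ_Suc[OF D_null] G_X_null)
  moreover have "P (Suc (Suc k)) $ i - P (Suc k) $ i
      = T i (D k i) - T i (D (Suc k) i) - (G i (X (Suc k) $ i) - G i (X k $ i))" for k
    by (simp add: P_Suc_eq)
  ultimately show "(\<lambda>k. P (Suc (Suc k)) $ i - P (Suc k) $ i) \<longlonglongrightarrow> 0"
    by simp
qed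

text \<open>The dual update read backwards: the residual is the multiplier step divided by
  \<open>\<sigma> i\<close>.\<close>

lemma consensus_null: "(\<lambda>k. X k $ i - y k) \<longlonglongrightarrow> 0"
proof (rule LIMSEQ_imp_Suc)
  have "(\<lambda>k. (1 / \<sigma> i) *\<^sub>R (P (Suc k) $ i - P k $ i)) \<longlonglongrightarrow> (1 / \<sigma> i) *\<^sub>R 0"
    by (intro tendsto_scaleR tendsto_const P_steps_null)
  moreover have "X (Suc k) $ i - y (Suc k) = (1 / \<sigma> i) *\<^sub>R (P (Suc k) $ i - P k $ i)" for k
    using \<sigma>_pos[of i] by (simp add: P_Suc)
  ultimately show "(\<lambda>k. X (Suc k) $ i - y (Suc k)) \<longlonglongrightarrow> 0"
    by simp
qed

lemma multiplier_null: "(\<lambda>k. P k $ i + G i (y k)) \<longlonglongrightarrow> 0"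
proof (rule LIMSEQ_imp_Suc)
  \<comment> \<open>The gradient in \<open>P_Suc_eq\<close> is moved from \<open>X k\<close> via
    \<open>X (Suc k)\<close> to \<open>y (Suc k)\<close>; each move vanishes by Lipschitz
    continuity.\<close>
  have "(\<lambda>k. (G i (X (Suc k) $ i) - G i (X k $ i)) - (G i (X (Suc k) $ i) - G i (y (Suc k)))
      - T i (D k i)) \<longlonglongrightarrow> 0 - 0 - 0"
    by (intro tendsto_diff T_null D_null G_X_null LIMSEQ_Suc[OF G_diff_null] consensus_null)
  moreover have "P (Suc k) $ i + G i (y (Suc k)) = (G i (X (Suc k) $ i) - G i (X k $ i))
      - (G i (X (Suc k) $ i) - G i (y (Suc k))) - T i (D k i)" for k
    by (simp add: P_Suc_eq)
  ultimately show "(\<lambda>k. P (Suc k) $ i + G i (y (Suc k))) \<longlonglongrightarrow> 0"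
    by (simp only: diff_zero)
qed

lemma multiplier_sum_null: "(\<lambda>k. \<Sum>i\<in>UNIV. P k $ i) \<longlonglongrightarrow> 0"
proof (rule tendsto_0_if_subseq_and_steps[OF k0_pos])
  have "(\<lambda>k. \<Sum>i\<in>UNIV. P (Suc k) $ i - P k $ i) \<longlonglongrightarrow> (\<Sum>i\<in>(UNIV :: 'm set). 0)"
    by (intro tendsto_sum P_steps_null)
  then show "(\<lambda>k. (\<Sum>i\<in>UNIV. P (Suc k) $ i) - (\<Sum>i\<in>UNIV. P k $ i)) \<longlonglongrightarrow> 0"
    by (simp add: sum_subtractf)
  \<comment> \<open>At multiples of \<open>k0\<close> the aggregation formula equates the multiplier
    sum with this sum, once \<open>y k\<close> cancels. Inserting \<open>y k\<close> splits it into
    a step of \<open>y\<close> and consensus residuals.\<close>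
  have "(\<lambda>k. \<Sum>i\<in>UNIV. \<sigma> i *\<^sub>R ((y (Suc k) - y k) - (X k $ i - y k)))
      \<longlonglongrightarrow> (\<Sum>i\<in>UNIV. \<sigma> i *\<^sub>R (0 - 0))"
    by (intro tendsto_sum tendsto_scaleR tendsto_diff tendsto_const y_steps_null consensus_null)
  then have "(\<lambda>k. \<Sum>i\<in>UNIV. \<sigma> i *\<^sub>R (y (Suc k) - X k $ i)) \<longlonglongrightarrow> 0"
    by simp
  moreover have "filterlim (\<lambda>j. k0 * j) sequentially sequentially"
    using k0_pos by (intro filterlim_subseq) (auto simp: strict_mono_def)
  ultimately have "(\<lambda>j. \<Sum>i\<in>UNIV. \<sigma> i *\<^sub>R (y (Suc (k0 * j)) - X (k0 * j) $ i)) \<longlonglongrightarrow> 0"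
    by (rule filterlim_compose)
  moreover have "(\<Sum>i\<in>UNIV. P (k0 * j) $ i)
      = (\<Sum>i\<in>UNIV. \<sigma> i *\<^sub>R (y (Suc (k0 * j)) - X (k0 * j) $ i))" for j
    using y_aggregate[of "k0 * j"]
    by (simp add: scaleR_diff_right sum_subtractf scaleR_sum_left[symmetric] S_def[symmetric])
  ultimately show "(\<lambda>j. \<Sum>i\<in>UNIV. P (k0 * j) $ i) \<longlonglongrightarrow> 0"
    by simp
qed

text \<open>Asymptotically \<open>X\<close> and \<open>P\<close> are functions of \<open>y\<close>.
  A general index map serves both a subsequence at an accumulation point and the whole
  sequence.\<close>

lemma limits_along:
  assumes \<rho>: "filterlim \<rho> sequentially sequentially" and lim: "(\<lambda>n. y (\<rho> n)) \<longlonglongrightarrow> l"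
  shows "(\<lambda>n. X (\<rho> n) $ i) \<longlonglongrightarrow> l" and "(\<lambda>n. P (\<rho> n) $ i) \<longlonglongrightarrow> - G i l"
proof -
  have "(\<lambda>n. (X (\<rho> n) $ i - y (\<rho> n)) + y (\<rho> n)) \<longlonglongrightarrow> 0 + l"
    by (intro tendsto_add filterlim_compose[OF consensus_null \<rho>] lim)
  then show "(\<lambda>n. X (\<rho> n) $ i) \<longlonglongrightarrow> l"
    by simp
  have "(\<lambda>n. (P (\<rho> n) $ i + G i (y (\<rho> n))) - (G i (y (\<rho> n)) - G i l) - G i l) \<longlonglongrightarrow> 0 - 0 - G i l"
    using lim
    by (intro tendsto_diff tendsto_const filterlim_compose[OF multiplier_null \<rho>] G_diff_null)
      (simp add: LIM_zero)
  then show "(\<lambda>n. P (\<rho> n) $ i) \<longlonglongrightarrow> - G i l"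
    by simp
qed

section \<open>Stationarity, boundedness and convergence of the iterates\<close>

lemma acc_point_eq:
  assumes "seq_acc_point (\<lambda>k. (y k, X k, P k)) (y', X', P')"
  shows "X' $ i = y'" and "P' $ i = - G i y'" and "(\<Sum>i\<in>UNIV. P' $ i) = 0"
proof -
  obtain \<rho> where "strict_mono \<rho>" and lim: "(\<lambda>n. (y (\<rho> n), X (\<rho> n), P (\<rho> n))) \<longlonglongrightarrow> (y', X', P')"
    using assms by (auto simp: seq_acc_point_def o_def)
  then have \<rho>: "filterlim \<rho> sequentially sequentially"
    by (simp add: filterlim_subseq)
  have y: "(\<lambda>n. y (\<rho> n)) \<longlonglongrightarrow> y'" and X: "(\<lambda>n. X (\<rho> n)) \<longlonglongrightarrow> X'" and P: "(\<lambda>n. P (\<rho> n)) \<longlonglongrightarrow> P'"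
    using tendsto_fst[OF lim] tendsto_fst[OF tendsto_snd[OF lim]] tendsto_snd[OF tendsto_snd[OF lim]]
    by simp_all
  show "X' $ i = y'"
    using LIMSEQ_unique[OF tendsto_vec_nth[OF X] limits_along(1)[OF \<rho> y]] .
  show "P' $ i = - G i y'"
    using LIMSEQ_unique[OF tendsto_vec_nth[OF P] limits_along(2)[OF \<rho> y]] .
  have "(\<lambda>n. \<Sum>i\<in>UNIV. P (\<rho> n) $ i) \<longlonglongrightarrow> (\<Sum>i\<in>UNIV. P' $ i)"
    by (intro tendsto_sum tendsto_vec_nth P)
  then show "(\<Sum>i\<in>UNIV. P' $ i) = 0"
    using LIMSEQ_unique filterlim_compose[OF multiplier_sum_null \<rho>] by blast
qed

lemma acc_point_stationary:
  assumes "seq_acc_point (\<lambda>k. (y k, X k, P k)) (y', X', P')"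
  shows "stationary_P' w f y' X' P'" and "stationary_P w f y'"
proof -
  note acc = acc_point_eq[OF assms]
  show "stationary_P' w f y' X' P'"
    unfolding stationary_P'_def using acc differentiable by (simp add: G_def)
  have D: "GDERIV (objective w f) y' :> (\<Sum>i\<in>UNIV. w i *\<^sub>R grad (f i) y')"
    by (intro GDERIV_objective differentiable)
  moreover have "(\<Sum>i\<in>UNIV. w i *\<^sub>R grad (f i) y') = 0"
    using acc(2,3) by (simp add: G_def sum_negf)
  ultimately have "grad (objective w f) y' = 0"
    by (simp add: grad_unique)
  moreover have "objective w f differentiable (at y')"
    using D by (auto simp: gderiv_def differentiable_def)
  ultimately show "stationary_P w f y'"
    by (simp add: stationary_P_def)
qed

text \<open>The level set bounds \<open>y\<close> from index 1 on, \<open>y 0\<close> being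
  arbitrary. Convergent residuals carry the bound to \<open>X\<close>, and, as \<open>G\<close> is
  Lipschitz and so bounded along \<open>y\<close>, to \<open>P\<close>.\<close>

lemma iterates_bounded:
  assumes "bounded (level_set w f (\<phi> 1))"
  shows "bounded ((\<lambda>k. (y k, X k, P k)) ` {1..})"
proof -
  have "y ` {1..} \<subseteq> level_set w f (\<phi> 1)"
    using y_in_level_set by (auto simp: Suc_le_eq gr0_conv_Suc)
  with assms have y: "bounded (y ` {1..})"
    by (rule bounded_subset)
  have "bounded ((\<lambda>k. (X k $ i - y k) + y k) ` {1..})" for i
    by (intro bounded_plus_comp y bounded_subset[OF convergent_imp_bounded[OF consensus_null[of i]]]) auto
  then have "bounded ((\<lambda>k. X k $ i) ` {1..})" for i
    by (simp only: diff_add_cancel)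
  then have X: "bounded (X ` {1..})"
    by (rule bounded_vec_image)
  have G: "bounded ((\<lambda>k. G i (y k)) ` {1..})" for i
  proof -
    obtain B where B: "\<And>k. k \<ge> 1 \<Longrightarrow> norm (y k) \<le> B"
      using y by (auto simp: bounded_iff)
    have "norm (G i (y k)) \<le> norm (G i 0) + w i * r i * B" if "k \<ge> 1" for k
    proof -
      have "norm (G i (y k)) \<le> norm (G i 0) + norm (G i (y k) - G i 0)"
        by (metis norm_triangle_sub)
      also have "norm (G i (y k) - G i 0) \<le> w i * r i * norm (y k)"
        using G_lipschitz[of i "y k" 0] by simp
      also have "\<dots> \<le> w i * r i * B"
        using B[OF that] wr_pos[of i] by (intro mult_left_mono) auto
      finally show ?thesis
        by simp
    qed
    then show ?thesis
      by (auto simp: bounded_iff)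
  qed
  have "bounded ((\<lambda>k. (P k $ i + G i (y k)) - G i (y k)) ` {1..})" for i
    by (intro bounded_minus_comp G bounded_subset[OF convergent_imp_bounded[OF multiplier_null[of i]]]) auto
  then have "bounded ((\<lambda>k. P k $ i) ` {1..})" for i
    by (simp only: add_diff_cancel)
  then have P: "bounded (P ` {1..})"
    by (rule bounded_vec_image)
  show ?thesis
    by (rule bounded_subset[OF bounded_Times[OF y bounded_Times[OF X P]]]) auto
qed

text \<open>Isolation forces \<open>y\<close> to converge; \<open>X\<close> and \<open>P\<close>
  follow by \<open>limits_along\<close>, and \<open>acc_point_eq\<close> identifies their limits
  with the given ones.\<close>

lemma iterates_converge:
  assumes acc: "seq_acc_point (\<lambda>k. (y k, X k, P k)) (y', X', P')"
    and iso: "y' isolated_in {z. seq_acc_point y z}"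
  shows "(\<lambda>k. (y k, X k, P k)) \<longlonglongrightarrow> (y', X', P')"
proof -
  have y: "y \<longlonglongrightarrow> y'"
    by (rule tendsto_isolated_acc_point[OF y_steps_null iso])
  note lim = limits_along[OF filterlim_ident, of y', OF y]
  have "X \<longlonglongrightarrow> X'" "P \<longlonglongrightarrow> P'"
    by (rule vec_tendstoI, simp only: acc_point_eq[OF acc] lim)+
  with y show ?thesis
    by (intro tendsto_Pair)
qed

end

theorem theorem4p2:
  fixes w :: "'m::finite \<Rightarrow> real"
    and f :: "'m \<Rightarrow> real^'n \<Rightarrow> real"
    and r \<sigma> :: "'m \<Rightarrow> real"
    and \<Theta> :: "'m \<Rightarrow> real^'n^'n"
    and k0 :: nat
    and x y :: "nat \<Rightarrow> real^'n"
    and X P :: "nat \<Rightarrow> real^'n^'m"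
  assumes w_pos: "\<And>i. w i > 0"
    and w_sum: "(\<Sum>i\<in>UNIV. w i) = 1"
    and f_bdd_below: "\<And>i. bdd_below (range (f i))"
    and r_pos: "\<And>i. r i > 0"
    and f_grad_lipschitz: "\<And>i. gradient_lipschitz (r i) (f i)"
    and \<Theta>_psd: "\<And>i. sym_psd (\<Theta> i)"
    and \<Theta>_le: "\<And>i. loewner_le (\<Theta> i) (mat (r i))"
    and \<Theta>_majorant: "\<And>i u v. f i u \<le> f i v + grad (f i) v \<bullet> (u - v)
                              + 1 / 2 * ((\<Theta> i *v (u - v)) \<bullet> (u - v))"
    and \<sigma>_pos: "\<And>i. \<sigma> i > 0"
    and \<sigma>_large: "\<And>i. \<sigma> i > 3 * sqrt 2 * w i * r i"
    and k0_pos: "k0 > 0"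
    and iterates: "ICEADMM w f \<sigma> \<Theta> k0 x y X P"
    and level_bounded: "bounded (level_set w f (merit w f \<sigma> r y X P 1))"
  shows "(bounded ((\<lambda>k. (y k, X k, P k)) ` {1..}) \<and>
     (\<forall>y' X' P'. seq_acc_point (\<lambda>k. (y k, X k, P k)) (y', X', P') \<longrightarrow>
        stationary_P' w f y' X' P' \<and> stationary_P w f y')) \<and>
    (\<forall>y' X' P'. seq_acc_point (\<lambda>k. (y k, X k, P k)) (y', X', P') \<and>
        y' isolated_in {z. seq_acc_point y z} \<longrightarrow>
        (\<lambda>k. (y k, X k, P k)) \<longlonglongrightarrow> (y', X', P'))"
proof -
  interpret iceadmm w f r \<sigma> \<Theta> k0 x y X P
    by unfold_locales (fact assms)+
  show ?thesis
    using iterates_bounded[OF level_bounded] acc_point_stationary iterates_converge by blast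
qed

end
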